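(* Let $\mathcal A$ be a unital $C^*$-algebra. The topology on the state space $S(\mathcal A)$ induced by the inclusion $S(\mathcal A)\subseteq QS(\mathcal A)$ coincides with the weak$^*$-topology.
   Context: A quasi-state on $\mathcal A$ is a map $\mu:\mathcal A\to\mathbb C$ that is linear on every unital commutative $C^*$-subalgebra of $\mathcal A$ (subalgebras contain the unit of $\mathcal A$), satisfies $\mu(a+ib)=\mu(a)+i\mu(b)$ for self-adjoint $a,b\in\mathcal A$, $\mu(a^*a)\ge0$ for all $a\in\mathcal A$, and $\mu(1)=1$. $QS(\mathcal A)$ is the set of all quasi-states with the projective topology: it is identified, via $\mu\mapsto(\mu|_{\mathcal A_\alpha})_\alpha$, with the projective limit of the state spaces $S(\mathcal A_\alpha)$ (each with its weak$^*$-topology) over all unital commutative $C^*$-subalgebras $\mathcal A_\alpha$ of $\mathcal A$ and the restriction maps between them; i.e. it carries the coarsest topology making every restriction map $QS(\mathcal A)\to S(\mathcal A_\alpha)$ continuous. Every state is a quasi-state, which gives the inclusion $S(\mathcal A)\subseteq QS(\mathcal A)$. *)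

theory Defs
  imports "HOL-Analysis.Analysis"
begin

text \<open>
  Multiplication, unit, norm, the real vector space structure and completeness come from the
  library classes; complex scalars and the involution are added here.  The library classes contain
  \<open>1 \<noteq> 0\<close> and \<open>norm 1 = 1\<close>, so the zero algebra (which has neither states nor
  quasi-states) is excluded.
\<close>

class unital_cstar_algebra = real_normed_algebra_1 + banach +
  fixes scaleC :: "complex \<Rightarrow> 'a \<Rightarrow> 'a" (infixr "*\<^sub>C" 75)
    and adj :: "'a \<Rightarrow> 'a"
  assumes scaleC_add_right: "c *\<^sub>C (x + y) = c *\<^sub>C x + c *\<^sub>C y"
    and scaleC_add_left: "(c + d) *\<^sub>C x = c *\<^sub>C x + d *\<^sub>C x"
    and scaleC_scaleC: "c *\<^sub>C (d *\<^sub>C x) = (c * d) *\<^sub>C x"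
    and scaleR_scaleC: "scaleR r x = complex_of_real r *\<^sub>C x"
    and scaleC_mult_left: "(c *\<^sub>C x) * y = c *\<^sub>C (x * y)"
    and scaleC_mult_right: "x * (c *\<^sub>C y) = c *\<^sub>C (x * y)"
    and norm_scaleC: "norm (c *\<^sub>C x) = cmod c * norm x"
    and adj_add: "adj (x + y) = adj x + adj y"
    and adj_scaleC: "adj (c *\<^sub>C x) = cnj c *\<^sub>C adj x"
    and adj_mult: "adj (x * y) = adj y * adj x"
    and adj_adj: "adj (adj x) = x"
    and cstar_identity: "norm (adj x * x) = (norm x)\<^sup>2"

instantiation complex :: unital_cstar_algebra
begin

definition scaleC_complex :: "complex \<Rightarrow> complex \<Rightarrow> complex"
  where "scaleC_complex c x = c * x"

definition adj_complex :: "complex \<Rightarrow> complex"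
  where "adj_complex = cnj"

instance
  by standard
    (simp_all add: scaleC_complex_def adj_complex_def distrib_left distrib_right norm_mult
      power2_eq_square scaleR_conv_of_real)

end

definition self_adjoint :: "'a::unital_cstar_algebra \<Rightarrow> bool"
  where "self_adjoint a \<longleftrightarrow> adj a = a"

definition unital_cstar_subalgebra :: "'a::unital_cstar_algebra set \<Rightarrow> bool"
  where "unital_cstar_subalgebra B \<longleftrightarrow>
    1 \<in> B \<and>
    (\<forall>x\<in>B. \<forall>y\<in>B. x + y \<in> B) \<and>
    (\<forall>c. \<forall>x\<in>B. c *\<^sub>C x \<in> B) \<and>
    (\<forall>x\<in>B. \<forall>y\<in>B. x * y \<in> B) \<and>
    (\<forall>x\<in>B. adj x \<in> B) \<and>
    closed B"

definition commutative_unital_cstar_subalgebra :: "'a::unital_cstar_algebra set \<Rightarrow> bool"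
  where "commutative_unital_cstar_subalgebra B \<longleftrightarrow>
    unital_cstar_subalgebra B \<and> (\<forall>x\<in>B. \<forall>y\<in>B. x * y = y * x)"

definition clinear_on :: "'a::unital_cstar_algebra set \<Rightarrow> ('a \<Rightarrow> complex) \<Rightarrow> bool"
  where "clinear_on B \<phi> \<longleftrightarrow>
    (\<forall>x\<in>B. \<forall>y\<in>B. \<phi> (x + y) = \<phi> x + \<phi> y) \<and>
    (\<forall>c. \<forall>x\<in>B. \<phi> (c *\<^sub>C x) = c * \<phi> x)"

text \<open>
  Functionals on a subalgebra \<open>B\<close> are represented by functions in \<open>extensional B\<close>, so that
  equality of functions is equality on \<open>B\<close>.  In particular \<open>extensional UNIV = UNIV\<close>, and
  \<open>state_space UNIV\<close> is the state space of the whole algebra.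
\<close>

definition state_space :: "'a::unital_cstar_algebra set \<Rightarrow> ('a \<Rightarrow> complex) set"
  where "state_space B = {\<phi> \<in> extensional B.
    clinear_on B \<phi> \<and> (\<forall>a\<in>B. \<phi> (adj a * a) \<in> \<real>\<^sub>\<ge>\<^sub>0) \<and> \<phi> 1 = 1}"

definition quasi_states :: "('a::unital_cstar_algebra \<Rightarrow> complex) set"
  where "quasi_states = {\<mu>.
    (\<forall>B. commutative_unital_cstar_subalgebra B \<longrightarrow> clinear_on B \<mu>) \<and>
    (\<forall>a b. self_adjoint a \<longrightarrow> self_adjoint b \<longrightarrow> \<mu> (a + \<i> *\<^sub>C b) = \<mu> a + \<i> * \<mu> b) \<and>
    (\<forall>a. \<mu> (adj a * a) \<in> \<real>\<^sub>\<ge>\<^sub>0) \<and>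
    \<mu> 1 = 1}"

text \<open>
  The coarsest topology on \<open>X\<close> for which every \<open>f i\<close> with \<open>i \<in> I\<close> is continuous into \<open>T i\<close>.
  The set \<open>X\<close> is added to the subbase since \<open>topology_generated_by\<close> takes the union of the
  subbase as the underlying space.
\<close>

definition initial_topology ::
    "'x set \<Rightarrow> 'i set \<Rightarrow> ('i \<Rightarrow> 'x \<Rightarrow> 'y) \<Rightarrow> ('i \<Rightarrow> 'y topology) \<Rightarrow> 'x topology"
  where "initial_topology X I f T =
    topology_generated_by (insert X {{x \<in> X. f i x \<in> U} | i U. i \<in> I \<and> openin (T i) U})"

definition weak_star_state_topology ::
    "'a::unital_cstar_algebra set \<Rightarrow> ('a \<Rightarrow> complex) topology"
  where "weak_star_state_topology B =
    initial_topology (state_space B) B (\<lambda>a \<phi>. \<phi> a) (\<lambda>_. euclidean)"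

definition quasi_state_topology :: "('a::unital_cstar_algebra \<Rightarrow> complex) topology"
  where "quasi_state_topology =
    initial_topology quasi_states {B. commutative_unital_cstar_subalgebra B}
      (\<lambda>B \<mu>. restrict \<mu> B) weak_star_state_topology"

lemma topspace_initial_topology [simp]: "topspace (initial_topology X I f T) = X"
  by (auto simp: initial_topology_def)

lemma restrict_quasi_state_in_state_space:
  assumes mu: "\<mu> \<in> quasi_states" and B: "commutative_unital_cstar_subalgebra B"
  shows "restrict \<mu> B \<in> state_space B"
proof -
  have sub: "1 \<in> B" "\<And>x y. x \<in> B \<Longrightarrow> y \<in> B \<Longrightarrow> x + y \<in> B" "\<And>c x. x \<in> B \<Longrightarrow> c *\<^sub>C x \<in> B"
      "\<And>x y. x \<in> B \<Longrightarrow> y \<in> B \<Longrightarrow> x * y \<in> B" "\<And>x. x \<in> B \<Longrightarrow> adj x \<in> B"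
    using B unfolding commutative_unital_cstar_subalgebra_def unital_cstar_subalgebra_def by blast+
  have q: "clinear_on B \<mu>" "\<And>a. \<mu> (adj a * a) \<in> \<real>\<^sub>\<ge>\<^sub>0" "\<mu> 1 = 1"
    using mu B unfolding quasi_states_def by blast+
  have "clinear_on B (restrict \<mu> B)"
    using q(1) sub(2,3) unfolding clinear_on_def by simp
  with q(2,3) sub show ?thesis
    unfolding state_space_def by simp
qed

lemma continuous_map_initial_topology:
  assumes "i \<in> I" "f i \<in> X \<rightarrow> topspace (T i)"
  shows "continuous_map (initial_topology X I f T) (T i) (f i)"
  unfolding continuous_map_def
proof (intro conjI allI impI)
  show "f i \<in> topspace (initial_topology X I f T) \<rightarrow> topspace (T i)"
    using assms by simp
next
  fix U assume "openin (T i) U"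
  then show "openin (initial_topology X I f T)
      {x \<in> topspace (initial_topology X I f T). f i x \<in> U}"
    unfolding topspace_initial_topology unfolding initial_topology_def
    using assms(1) by (intro topology_generated_by_Basis) blast
qed

lemma initial_topology_coarsest:
  assumes "topspace S = X" "\<And>i. i \<in> I \<Longrightarrow> continuous_map S (T i) (f i)"
    and "openin (initial_topology X I f T) W"
  shows "openin S W"
proof -
  have sub: "openin S V"
    if V: "V \<in> insert X {{x \<in> X. f i x \<in> U} | i U. i \<in> I \<and> openin (T i) U}" for V
  proof -
    consider "V = X" | i U where "V = {x \<in> X. f i x \<in> U}" "i \<in> I" "openin (T i) U"
      using V by blast
    then show ?thesis
    proof cases
      case 1
      then show ?thesis using assms(1) openin_topspace by metis
    next
      case (2 i U)
      then show ?thesis using assms(1) assms(2)[OF 2(2)] unfolding continuous_map_def by metis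
    qed
  qed
  have "generate_topology_on (insert X {{x \<in> X. f i x \<in> U} | i U. i \<in> I \<and> openin (T i) U}) W"
    using assms(3) by (simp add: initial_topology_def openin_topology_generated_by_iff)
  then show ?thesis
  proof induction
    case Empty
    show ?case by (rule openin_empty)
  next
    case (Int a b)
    then show ?case by (blast)
  next
    case (UN K)
    then show ?case by (blast)
  next
    case (Basis V)
    then show ?case by (rule sub)
  qed
qed

lemma state_space_subset_quasi_states: "state_space UNIV \<subseteq> quasi_states"
  unfolding state_space_def quasi_states_def clinear_on_def by (rule subsetI) simp

end

(* States are complex linear, so the value of a state at any element is determined by its values
   at the real and imaginary parts.  Each of these lies in a commutative unital C*-subalgebra, so
   evaluation there factors continuously through a restriction map. *)
theory Submission imports Defs
begin

text \<open>Openness of preimages need only be tested on the subbase: \<open>X\<close> pulls back to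
  the whole space, and the other members pull back to preimages under the composites of
  \<open>g\<close> with \<open>f i\<close>. This universal property serves for the quasi-state
  topology and again for the weak* topology on each subalgebra.\<close>

lemma continuous_map_into_initial_topology:
  assumes g: "g \<in> topspace S \<rightarrow> X"
    and fg: "\<And>i. i \<in> I \<Longrightarrow> continuous_map S (T i) (\<lambda>x. f i (g x))"
  shows "continuous_map S (initial_topology X I f T) g"
  unfolding initial_topology_def
proof (rule continuous_on_generated_topo)
  show "g ` topspace S \<subseteq> \<Union> (insert X {{x \<in> X. f i x \<in> U} | i U. i \<in> I \<and> openin (T i) U})"
    using g by auto
next
  fix V assume "V \<in> insert X {{x \<in> X. f i x \<in> U} | i U. i \<in> I \<and> openin (T i) U}"
  then consider "V = X" | i U where "V = {x \<in> X. f i x \<in> U}" "i \<in> I" "openin (T i) U"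
    by blast
  then show "openin S (g -` V \<inter> topspace S)"
  proof cases
    case 1
    then have "g -` V \<inter> topspace S = topspace S"
      using g by auto
    then show ?thesis by simp
  next
    case (2 i U)
    then have "g -` V \<inter> topspace S = {x \<in> topspace S. f i (g x) \<in> U}"
      using g by auto
    then show ?thesis
      using fg[OF 2(2)] 2(3) by (simp add: continuous_map_def)
  qed
qed

lemma topspace_weak_star_state_topology [simp]:
  "topspace (weak_star_state_topology B) = state_space B"
  by (simp add: weak_star_state_topology_def)

lemma topspace_quasi_state_topology [simp]: "topspace quasi_state_topology = quasi_states"
  by (simp add: quasi_state_topology_def)

lemma continuous_map_weak_star_eval:
  assumes "a \<in> B"
  shows "continuous_map (weak_star_state_topology B) euclidean (\<lambda>\<phi>. \<phi> a)"
  unfolding weak_star_state_topology_def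
  using continuous_map_initial_topology[of a B "\<lambda>a \<phi>. \<phi> a" _ "\<lambda>_. euclidean"] assms by simp

lemma continuous_map_quasi_state_restrict:
  assumes "commutative_unital_cstar_subalgebra B"
  shows "continuous_map quasi_state_topology (weak_star_state_topology B) (\<lambda>\<mu>. restrict \<mu> B)"
  unfolding quasi_state_topology_def
  using continuous_map_initial_topology[of B "{B. commutative_unital_cstar_subalgebra B}"
      "\<lambda>B \<mu>. restrict \<mu> B" quasi_states weak_star_state_topology]
    restrict_quasi_state_in_state_space[OF _ assms] assms
  by (simp add: Pi_iff)

text \<open>Evaluation at \<open>a\<close> is restriction to \<open>B\<close> followed by evaluation
  at \<open>a\<close> on \<open>state_space B\<close>; both factors are continuous.\<close>

lemma continuous_map_quasi_state_eval:
  assumes B: "commutative_unital_cstar_subalgebra B" and a: "a \<in> B"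
  shows "continuous_map quasi_state_topology euclidean (\<lambda>\<mu>. \<mu> a)"
  using continuous_map_compose[OF continuous_map_quasi_state_restrict[OF B]
      continuous_map_weak_star_eval[OF a]] a
  by (simp add: o_def)

text \<open>The witness is the bicommutant of \<open>h\<close>, for which commutativity and closedness are
  immediate; the subalgebra generated by \<open>h\<close> would need a density argument.\<close>

lemma self_adjoint_in_commutative_subalgebra:
  fixes h :: "'a::unital_cstar_algebra"
  assumes h: "self_adjoint h"
  obtains B where "commutative_unital_cstar_subalgebra B" "h \<in> B"
proof -
  define C where "C = {y. y * h = h * y}"
  define B where "B = {x. \<forall>y\<in>C. x * y = y * x}"
  \<comment> \<open>Self-adjointness of \<open>h\<close> makes its commutant closed under
    \<open>adj\<close>, and the bicommutant inherits this.\<close>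
  have adjC: "adj y \<in> C" if "y \<in> C" for y
  proof -
    have "adj (y * h) = adj (h * y)"
      using that by (simp add: C_def)
    then show ?thesis
      using h by (simp add: C_def adj_mult self_adjoint_def)
  qed
  have adjB: "adj x \<in> B" if x: "x \<in> B" for x
  proof -
    have "adj x * y = y * adj x" if "y \<in> C" for y
    proof -
      have "adj (x * adj y) = adj (adj y * x)"
        using x adjC[OF that] by (simp add: B_def)
      then show ?thesis
        by (simp add: adj_mult adj_adj)
    qed
    then show ?thesis by (simp add: B_def)
  qed
  have mult: "x * z \<in> B" if "x \<in> B" "z \<in> B" for x z
  proof -
    have "x * z * y = y * (x * z)" if "y \<in> C" for y
    proof -
      have xz: "x * y = y * x" "z * y = y * z"
        using \<open>x \<in> B\<close> \<open>z \<in> B\<close> that by (auto simp: B_def)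
      have "x * z * y = x * y * z"
        by (simp add: mult.assoc xz(2))
      then show ?thesis
        by (simp add: xz(1) mult.assoc)
    qed
    then show ?thesis by (simp add: B_def)
  qed
  have "B = (\<Inter>y\<in>C. {x. x * y = y * x})"
    by (auto simp: B_def)
  \<comment> \<open>Multiplication is continuous, so each set is an equalizer of two continuous
    maps.\<close>
  moreover have "closed {x. x * y = y * x}" for y :: 'a
    by (intro closed_Collect_eq continuous_intros)
  ultimately have "closed B" by auto
  then have "unital_cstar_subalgebra B"
    using mult adjB unfolding unital_cstar_subalgebra_def
    by (auto simp: B_def distrib_left distrib_right scaleC_mult_left scaleC_mult_right)
  \<comment> \<open>Since \<open>h\<close> is in \<open>C\<close>, elements of \<open>B\<close>
    commute with \<open>h\<close>. As \<open>B\<close> commutes with all of \<open>C\<close>, it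
    then commutes with itself.\<close>
  moreover have "B \<subseteq> C"
    unfolding B_def C_def by blast
  then have "x * y = y * x" if "x \<in> B" "y \<in> B" for x y
    using that unfolding B_def by blast
  moreover have "h \<in> B"
    unfolding B_def C_def by (blast intro: sym)
  ultimately show thesis
    using that unfolding commutative_unital_cstar_subalgebra_def by blast
qed

lemma cartesian_decomposition:
  fixes a :: "'a::unital_cstar_algebra"
  obtains h k where "self_adjoint h" "self_adjoint k" "a = h + \<i> *\<^sub>C k"
proof
  \<comment> \<open>The real and imaginary parts of \<open>a\<close>, the latter being
    \<open>a - adj a\<close> divided by 2i.\<close>
  define h k where "h = (1/2) *\<^sub>C a + (1/2) *\<^sub>C adj a"
    and "k = (- \<i>/2) *\<^sub>C a + (\<i>/2) *\<^sub>C adj a"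
  show "self_adjoint h" "self_adjoint k"
    by (simp_all add: h_def k_def self_adjoint_def adj_add adj_scaleC adj_adj add.commute)
  have "h + \<i> *\<^sub>C k = ((1/2) *\<^sub>C a + (1/2) *\<^sub>C a) + ((1/2) *\<^sub>C adj a + (-1/2) *\<^sub>C adj a)"
    by (simp add: h_def k_def scaleC_add_right scaleC_scaleC add_ac)
  also have "\<dots> = 1 *\<^sub>C a + 0 *\<^sub>C adj a"
    by (simp flip: scaleC_add_left)
  \<comment> \<open>The scalars 1 and 0 act as expected through the real scalar multiplication, by
    \<open>scaleR_scaleC\<close>.\<close>
  also have "\<dots> = a"
    using scaleR_scaleC[of 1 a] scaleR_scaleC[of 0 "adj a"] by simp
  finally show "a = h + \<i> *\<^sub>C k" by simp
qed

theorem corollary3p7: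
  "subtopology (quasi_state_topology :: ('a::unital_cstar_algebra \<Rightarrow> complex) topology)
     (state_space UNIV)
   = weak_star_state_topology UNIV"
proof -
  let ?Q = "quasi_state_topology :: ('a \<Rightarrow> complex) topology"
  let ?S = "state_space UNIV :: ('a \<Rightarrow> complex) set"
  let ?W = "weak_star_state_topology (UNIV :: 'a set)"
  have top: "topspace (subtopology ?Q ?S) = ?S"
    using state_space_subset_quasi_states by auto
  \<comment> \<open>This makes the induced topology at least as fine as the weak* one. An arbitrary
    \<open>a\<close> may lie in no commutative subalgebra, hence the detour through its self-adjoint
    parts.\<close>
  have eval: "continuous_map (subtopology ?Q ?S) euclidean (\<lambda>\<phi>. \<phi> a)" for a
  proof -
    obtain h k where hk: "self_adjoint h" "self_adjoint k" "a = h + \<i> *\<^sub>C k"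
      by (rule cartesian_decomposition)
    have *: "continuous_map (subtopology ?Q ?S) euclidean (\<lambda>\<phi>. \<phi> b)" if "self_adjoint b" for b
      using self_adjoint_in_commutative_subalgebra[OF that] continuous_map_quasi_state_eval
        continuous_map_from_subtopology by metis
    have "continuous_map (subtopology ?Q ?S) euclidean (\<lambda>\<phi>. \<phi> h + \<i> * \<phi> k)"
      by (intro continuous_map_add * hk continuous_map_compose[OF *, unfolded o_def, of k euclidean "(*) \<i>"])
        (simp add: continuous_intros)
    moreover have "\<phi> a = \<phi> h + \<i> * \<phi> k" if "\<phi> \<in> ?S" for \<phi>
      using that hk(3) by (simp add: state_space_def clinear_on_def)
    ultimately show ?thesis
      using top by (auto elim!: continuous_map_eq)
  qed
  \<comment> \<open>The converse comparison: two uses of the universal property reduce it to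
    evaluations at points of commutative subalgebras, which are weak* continuous on states.\<close>
  have incl: "continuous_map ?W ?Q (\<lambda>\<phi>. \<phi>)"
    unfolding quasi_state_topology_def
  proof (rule continuous_map_into_initial_topology)
    show "(\<lambda>\<phi>. \<phi>) \<in> topspace ?W \<rightarrow> quasi_states"
      using state_space_subset_quasi_states by auto
  next
    fix B :: "'a set" assume "B \<in> {B. commutative_unital_cstar_subalgebra B}"
    then have "restrict \<phi> B \<in> state_space B" if "\<phi> \<in> ?S" for \<phi>
      using that state_space_subset_quasi_states restrict_quasi_state_in_state_space by blast
    then show "continuous_map ?W (weak_star_state_topology B) (\<lambda>\<phi>. restrict \<phi> B)"
      unfolding weak_star_state_topology_def[of B]
      by (intro continuous_map_into_initial_topology) (auto simp: continuous_map_weak_star_eval)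
  qed
  show ?thesis
  proof (rule topology_eq[THEN iffD2], intro allI iffI)
    fix U assume "openin (subtopology ?Q ?S) U"
    then obtain V where "openin ?Q V" "U = V \<inter> ?S"
      by (auto simp: openin_subtopology)
    \<comment> \<open>The trace of \<open>V\<close> on the states is its preimage under the
      inclusion.\<close>
    moreover have "V \<inter> ?S = {\<phi> \<in> topspace ?W. \<phi> \<in> V}"
      by auto
    ultimately show "openin ?W U"
      using incl by (simp add: continuous_map_def)
  next
    fix U assume "openin ?W U"
    then show "openin (subtopology ?Q ?S) U"
      unfolding weak_star_state_topology_def
      using initial_topology_coarsest[OF top] eval by metis
  qed
qed

end
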